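(* Let $\hat s\in\mathrm{Dom}_{\mathcal S}(\hat T_a)$ and $\hat f\in\mathrm{Dom}_{\mathcal W}(\hat T_a)$ be such that $\|\hat f\|_{\mathcal W}=\|\hat s\|_{\mathcal S}=1$. Then: 1. The expected value of $\hat f\otimes\hat s$ with respect to $\breve T_a$ is $$e_{\hat f\otimes\hat s}(\breve T_a)=-e^{\mathcal S}_{\hat s}(\ln|\omega|)+e^{\mathcal W}_{\hat f}(\ln|\omega'|).$$ 2. The variance of $\hat f\otimes\hat s$ with respect to $\breve T_a$ is $$v_{\hat f\otimes\hat s}(\breve T_a)=v^{\mathcal S}_{\hat s}(\ln|\omega|)+v^{\mathcal W}_{\hat f}(\ln|\omega'|).$$
   Context: Spaces: $\mathcal S=L^2(\mathbb R,d\omega)$, $\mathcal W=L^2(\mathbb R,\frac{1}{|\omega'|}d\omega')$ (complex-valued functions), and the window-signal space $\mathcal W\otimes\mathcal S=L^2(\mathbb R^2;\frac{1}{|\omega'|}d\omega'd\omega)$, where $\omega'$ is the window variable and $\omega$ the signal variable. For $\hat f\in\mathcal W,\hat s\in\mathcal S$, the simple function is $(\hat f\otimes\hat s)(\omega',\omega)=\overline{\hat f(\omega')}\,\hat s(\omega)$. Inner products are linear in the first argument. Moments: $e_f(T)=\langle Tf,f\rangle$ and $v_f(T)=\|(T-e_f(T))f\|^2$; a superscript $\mathcal S$ or $\mathcal W$ indicates the space in which these are computed, and without superscript they are computed in $\mathcal W\otimes\mathcal S$. The symbols $\ln|\omega|$, $\ln|\omega'|$ in place of an operator denote the corresponding multiplication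 operators. The operator $\breve T_a$ (the pull-back to $\mathcal W\otimes\mathcal S$ of multiplication by the scale variable $a$ in the wavelet phase space) is the multiplication operator $\breve T_aF=(\ln|\omega'|-\ln|\omega|)F$ on the domain of all $F\in\mathcal W\otimes\mathcal S$ with $(\ln|\omega'|-\ln|\omega|)F\in\mathcal W\otimes\mathcal S$. $\mathrm{Dom}_{\mathcal S}(\hat T_a)=\{\hat s\in L^2(\mathbb R):\ln(|\omega|)\hat s\in L^2(\mathbb R)\}$ and $\mathrm{Dom}_{\mathcal W}(\hat T_a)=\{\hat f\in L^2(\mathbb R)\cap\mathcal W:\ln(|\omega'|)\hat f\in\mathcal W\}$. *)

theory Defs
  imports "HOL-Analysis.Analysis"
begin

text \<open>
  Elements of \<open>L\<^sup>2(M)\<close> are represented by Borel functions, not by classes modulo null sets;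
  inner products, norms and multiplication operators below respect almost everywhere equality.
\<close>

definition L2 :: "'a measure \<Rightarrow> ('a \<Rightarrow> complex) set" where
  "L2 M = {f \<in> borel_measurable M. integrable M (\<lambda>x. (cmod (f x))\<^sup>2)}"

definition L2_inner :: "'a measure \<Rightarrow> ('a \<Rightarrow> complex) \<Rightarrow> ('a \<Rightarrow> complex) \<Rightarrow> complex" where
  "L2_inner M f g = (LINT x|M. f x * cnj (g x))"

definition L2_norm :: "'a measure \<Rightarrow> ('a \<Rightarrow> complex) \<Rightarrow> real" where
  "L2_norm M f = sqrt (LINT x|M. (cmod (f x))\<^sup>2)"

definition mult_op :: "('a \<Rightarrow> real) \<Rightarrow> ('a \<Rightarrow> complex) \<Rightarrow> 'a \<Rightarrow> complex" where
  "mult_op h f = (\<lambda>x. of_real (h x) * f x)"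

text \<open>
  The moments are meaningful only for \<open>f\<close> in the domain of the operator \<open>T\<close>.
\<close>

definition op_expectation ::
  "'a measure \<Rightarrow> (('a \<Rightarrow> complex) \<Rightarrow> 'a \<Rightarrow> complex) \<Rightarrow> ('a \<Rightarrow> complex) \<Rightarrow> complex" where
  "op_expectation M T f = L2_inner M (T f) f"

definition op_variance ::
  "'a measure \<Rightarrow> (('a \<Rightarrow> complex) \<Rightarrow> 'a \<Rightarrow> complex) \<Rightarrow> ('a \<Rightarrow> complex) \<Rightarrow> real" where
  "op_variance M T f = (L2_norm M (\<lambda>x. T f x - op_expectation M T f * f x))\<^sup>2"

text \<open>
  The totalized values \<open>1 / 0 = 0\<close> and \<open>ln 0 = 0\<close> only matter on null sets.
\<close>

definition signal_measure :: "real measure" where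
  "signal_measure = lborel"

definition window_measure :: "real measure" where
  "window_measure = density lborel (\<lambda>\<omega>'. ennreal (1 / \<bar>\<omega>'\<bar>))"

text \<open>In pairs, the window variable comes first and the signal variable second.\<close>

definition window_signal_measure :: "(real \<times> real) measure" where
  "window_signal_measure = density lborel (\<lambda>(\<omega>', \<omega>). ennreal (1 / \<bar>\<omega>'\<bar>))"

definition simple_tensor :: "(real \<Rightarrow> complex) \<Rightarrow> (real \<Rightarrow> complex) \<Rightarrow> real \<times> real \<Rightarrow> complex" where
  "simple_tensor f s = (\<lambda>(\<omega>', \<omega>). cnj (f \<omega>') * s \<omega>)"

definition ln_abs_op :: "(real \<Rightarrow> complex) \<Rightarrow> real \<Rightarrow> complex" where
  "ln_abs_op = mult_op (\<lambda>\<omega>. ln \<bar>\<omega>\<bar>)"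

definition dom_signal :: "(real \<Rightarrow> complex) set" where
  "dom_signal = {s \<in> L2 signal_measure. ln_abs_op s \<in> L2 signal_measure}"

definition dom_window :: "(real \<Rightarrow> complex) set" where
  "dom_window = {f \<in> L2 lborel \<inter> L2 window_measure. ln_abs_op f \<in> L2 window_measure}"

definition scale_op :: "(real \<times> real \<Rightarrow> complex) \<Rightarrow> real \<times> real \<Rightarrow> complex" where
  "scale_op = mult_op (\<lambda>(\<omega>', \<omega>). ln \<bar>\<omega>'\<bar> - ln \<bar>\<omega>\<bar>)"

definition dom_scale_op :: "(real \<times> real \<Rightarrow> complex) set" where
  "dom_scale_op = {F \<in> L2 window_signal_measure. scale_op F \<in> L2 window_signal_measure}"

end

theory Submission
  imports Defs
begin

text \<open>
  The moments of a multiplication operator by a real function \<open>h\<close> in a unit vector \<open>f\<close> are those of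
  the random variable \<open>h\<close> under the probability density \<open>|f|\<^sup>2\<close>. The density of a simple tensor is a
  product density, so \<open>ln |\<omega>'|\<close> and \<open>ln |\<omega>|\<close> become independent: the expectation of their difference
  is the difference of the expectations, and its variance is the sum of the variances.
\<close>

text \<open>Translates the domain condition of a multiplication operator into a finite second moment
  of \<open>h\<close> under the density |f|^2.\<close>

lemma mult_op_mem_L2_iff:
  assumes "f \<in> L2 M" "h \<in> borel_measurable M"
  shows "mult_op h f \<in> L2 M \<longleftrightarrow> integrable M (\<lambda>x. (h x)\<^sup>2 * (cmod (f x))\<^sup>2)"
  using assms by (auto simp: L2_def mult_op_def norm_mult power_mult_distrib)

text \<open>The first moment is dominated by the sum of the zeroth and second moments, which are
  finite because \<open>f\<close> and \<open>mult_op h f\<close> are square integrable.\<close>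

lemma integrable_mult_L2_density:
  fixes h :: "'a \<Rightarrow> real"
  assumes "f \<in> L2 M" "mult_op h f \<in> L2 M" and h: "h \<in> borel_measurable M"
  shows "integrable M (\<lambda>x. h x * (cmod (f x))\<^sup>2)"
proof (rule Bochner_Integration.integrable_bound)
  have "integrable M (\<lambda>x. (h x)\<^sup>2 * (cmod (f x))\<^sup>2)"
    using assms mult_op_mem_L2_iff by blast
  then show "integrable M (\<lambda>x. (cmod (f x))\<^sup>2 + (h x)\<^sup>2 * (cmod (f x))\<^sup>2)"
    using assms(1) by (simp add: L2_def)
  show "(\<lambda>x. h x * (cmod (f x))\<^sup>2) \<in> borel_measurable M"
    using assms(1) h by (auto simp: L2_def)
  \<comment> \<open>From 2|t| \<le> t^2 + 1, the case of AM-GM with second entry 1.\<close>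
  have "\<bar>t\<bar> \<le> 1 + t\<^sup>2" for t :: real
    using sum_squares_bound[of "\<bar>t\<bar>" 1] by simp
  then have "\<bar>h x\<bar> * (cmod (f x))\<^sup>2 \<le> (1 + (h x)\<^sup>2) * (cmod (f x))\<^sup>2" for x
    by (intro mult_right_mono) auto
  then show "AE x in M. norm (h x * (cmod (f x))\<^sup>2)
      \<le> norm ((cmod (f x))\<^sup>2 + (h x)\<^sup>2 * (cmod (f x))\<^sup>2)"
    by (simp add: abs_mult algebra_simps)
qed

lemma L2_norm_eq_1_iff: "L2_norm M f = 1 \<longleftrightarrow> (LINT x|M. (cmod (f x))\<^sup>2) = 1"
  by (simp add: L2_norm_def)

text \<open>Since f times its conjugate is |f|^2, the integrand is real. Integrability need not be
  assumed: if it fails, both integrals take the default value 0.\<close>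

lemma op_expectation_mult_op:
  "op_expectation M (mult_op h) f = of_real (LINT x|M. h x * (cmod (f x))\<^sup>2)"
proof -
  have "mult_op h f x * cnj (f x) = of_real (h x * (cmod (f x))\<^sup>2)" for x
    by (simp only: mult_op_def mult.assoc of_real_mult complex_norm_square)
  then show ?thesis
    by (simp only: op_expectation_def L2_inner_def integral_complex_of_real)
qed

text \<open>The identity Var = E(h^2) - (E h)^2: expand the square, and let the unit norm turn the
  last term into e^2.\<close>

lemma op_variance_mult_op:
  fixes h :: "'a \<Rightarrow> real"
  assumes f: "f \<in> L2 M" "mult_op h f \<in> L2 M" and h: "h \<in> borel_measurable M"
    and unit: "L2_norm M f = 1"
  shows "op_variance M (mult_op h) f =
    (LINT x|M. (h x)\<^sup>2 * (cmod (f x))\<^sup>2) - (LINT x|M. h x * (cmod (f x))\<^sup>2)\<^sup>2"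
proof -
  define e where "e = (LINT x|M. h x * (cmod (f x))\<^sup>2)"
  \<comment> \<open>The expectation is real, so the centred operator is again multiplication by a
    real function, \<open>h - e\<close>.\<close>
  have "cmod (mult_op h f x - of_real e * f x) = \<bar>h x - e\<bar> * cmod (f x)" for x
    unfolding mult_op_def
    by (simp only: left_diff_distrib[symmetric] of_real_diff[symmetric] norm_mult norm_of_real)
  then have sq: "(cmod (mult_op h f x - of_real e * f x))\<^sup>2 =
      (h x)\<^sup>2 * (cmod (f x))\<^sup>2 - 2 * e * (h x * (cmod (f x))\<^sup>2) + e\<^sup>2 * (cmod (f x))\<^sup>2" for x
    by (simp add: power_mult_distrib power2_eq_square algebra_simps)
  have "op_variance M (mult_op h) f = (LINT x|M. (cmod (mult_op h f x - of_real e * f x))\<^sup>2)"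
    by (simp add: op_variance_def L2_norm_def op_expectation_mult_op e_def)
  also have "\<dots> = (LINT x|M. (h x)\<^sup>2 * (cmod (f x))\<^sup>2) - 2 * e * e + e\<^sup>2 * 1"
  proof -
    have "integrable M (\<lambda>x. (cmod (f x))\<^sup>2)" "integrable M (\<lambda>x. (h x)\<^sup>2 * (cmod (f x))\<^sup>2)"
      "integrable M (\<lambda>x. h x * (cmod (f x))\<^sup>2)"
      using f mult_op_mem_L2_iff[OF f(1) h] integrable_mult_L2_density[OF f h]
      by (auto simp: L2_def)
    moreover have "(LINT x|M. (cmod (f x))\<^sup>2) = 1"
      using unit by (simp add: L2_norm_eq_1_iff)
    ultimately show ?thesis
      by (simp add: sq e_def[symmetric])
  qed
  finally show ?thesis
    by (simp add: e_def power2_eq_square)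
qed

text \<open>Fubini for separated variables. Integrability and value are bundled in one predicate, so
  that sums of such products can be assembled by introduction rules.\<close>

lemma (in pair_sigma_finite) has_bochner_integral_pair_product:
  fixes p :: "'a \<Rightarrow> real" and q :: "'b \<Rightarrow> real"
  assumes p: "integrable M1 p" and q: "integrable M2 q"
  shows "has_bochner_integral (M1 \<Otimes>\<^sub>M M2) (\<lambda>z. p (fst z) * q (snd z))
    ((LINT x|M1. p x) * (LINT y|M2. q y))"
proof -
  have [measurable]: "p \<in> borel_measurable M1" "q \<in> borel_measurable M2"
    using p q by auto
  have int: "integrable (M1 \<Otimes>\<^sub>M M2) (\<lambda>z. p (fst z) * q (snd z))"
    by (rule Fubini_integrable) (use p q in \<open>auto simp: abs_mult\<close>)
  moreover have "(LINT z|(M1 \<Otimes>\<^sub>M M2). p (fst z) * q (snd z)) = (LINT x|M1. p x) * (LINT y|M2. q y)"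
    using integral_fst'[OF int] by simp
  ultimately show ?thesis
    by (simp add: has_bochner_integral_iff)
qed

lemma (in pair_sigma_finite) moments_difference_tensor:
  fixes a :: "'a \<Rightarrow> real" and b :: "'b \<Rightarrow> real"
    and f :: "'a \<Rightarrow> complex" and s :: "'b \<Rightarrow> complex"
  defines "F \<equiv> \<lambda>z. cnj (f (fst z)) * s (snd z)"
    and "d \<equiv> \<lambda>z. a (fst z) - b (snd z)"
  assumes f: "f \<in> L2 M1" "mult_op a f \<in> L2 M1" "L2_norm M1 f = 1"
    and s: "s \<in> L2 M2" "mult_op b s \<in> L2 M2" "L2_norm M2 s = 1"
    and [measurable]: "a \<in> borel_measurable M1" "b \<in> borel_measurable M2"
  shows "F \<in> L2 (M1 \<Otimes>\<^sub>M M2)"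
    and "mult_op d F \<in> L2 (M1 \<Otimes>\<^sub>M M2)"
    and "op_expectation (M1 \<Otimes>\<^sub>M M2) (mult_op d) F =
      op_expectation M1 (mult_op a) f - op_expectation M2 (mult_op b) s"
    and "op_variance (M1 \<Otimes>\<^sub>M M2) (mult_op d) F =
      op_variance M1 (mult_op a) f + op_variance M2 (mult_op b) s"
proof -
  let ?M = "M1 \<Otimes>\<^sub>M M2"
  define p where "p = (\<lambda>x. (cmod (f x))\<^sup>2)"
  define q where "q = (\<lambda>y. (cmod (s y))\<^sup>2)"
  have [measurable]: "f \<in> borel_measurable M1" "s \<in> borel_measurable M2"
    using f s by (auto simp: L2_def)
  have intp: "integrable M1 p" "integrable M1 (\<lambda>x. a x * p x)" "integrable M1 (\<lambda>x. (a x)\<^sup>2 * p x)"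
    using f mult_op_mem_L2_iff[of f M1 a] integrable_mult_L2_density[of f M1 a]
    by (auto simp: L2_def p_def)
  have intq: "integrable M2 q" "integrable M2 (\<lambda>y. b y * q y)" "integrable M2 (\<lambda>y. (b y)\<^sup>2 * q y)"
    using s mult_op_mem_L2_iff[of s M2 b] integrable_mult_L2_density[of s M2 b]
    by (auto simp: L2_def q_def)
  have norms: "integral\<^sup>L M1 p = 1" "integral\<^sup>L M2 q = 1"
    using f(3) s(3) by (simp_all add: L2_norm_eq_1_iff p_def q_def)
  have dens: "(cmod (F z))\<^sup>2 = p (fst z) * q (snd z)" for z
    by (simp add: F_def p_def q_def norm_mult power_mult_distrib)
  have [measurable]: "cnj \<in> borel_measurable borel"
    by (intro borel_measurable_continuous_onI continuous_intros)
  have F_meas: "F \<in> borel_measurable ?M"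
    unfolding F_def by measurable
  have d_meas: "d \<in> borel_measurable ?M"
    unfolding d_def by measurable
  have m0: "has_bochner_integral ?M (\<lambda>z. (cmod (F z))\<^sup>2) 1"
    using has_bochner_integral_pair_product[OF intp(1) intq(1)] by (simp add: dens norms)
  \<comment> \<open>The factors are grouped so that each term is a function of the first coordinate
    times a function of the second.\<close>
  have "has_bochner_integral ?M
      (\<lambda>z. a (fst z) * p (fst z) * q (snd z) - p (fst z) * (b (snd z) * q (snd z)))
      ((LINT x|M1. a x * p x) * integral\<^sup>L M2 q - integral\<^sup>L M1 p * (LINT y|M2. b y * q y))"
    by (intro has_bochner_integral_diff has_bochner_integral_pair_product intp intq)
  then have m1: "has_bochner_integral ?M (\<lambda>z. d z * (cmod (F z))\<^sup>2)
      ((LINT x|M1. a x * p x) - (LINT y|M2. b y * q y))"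
    by (simp add: dens d_def norms algebra_simps)
  \<comment> \<open>Expansion of (a - b)^2 under the product density. By independence the mixed term
    integrates to the product of the two first moments.\<close>
  have "has_bochner_integral ?M
      (\<lambda>z. (a (fst z))\<^sup>2 * p (fst z) * q (snd z)
        - 2 * (a (fst z) * p (fst z) * (b (snd z) * q (snd z)))
        + p (fst z) * ((b (snd z))\<^sup>2 * q (snd z)))
      ((LINT x|M1. (a x)\<^sup>2 * p x) * integral\<^sup>L M2 q
        - 2 * ((LINT x|M1. a x * p x) * (LINT y|M2. b y * q y))
        + integral\<^sup>L M1 p * (LINT y|M2. (b y)\<^sup>2 * q y))"
    by (intro has_bochner_integral_add has_bochner_integral_diff has_bochner_integral_mult_right
        has_bochner_integral_pair_product intp intq)
  then have m2: "has_bochner_integral ?M (\<lambda>z. (d z)\<^sup>2 * (cmod (F z))\<^sup>2)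
      ((LINT x|M1. (a x)\<^sup>2 * p x) - 2 * ((LINT x|M1. a x * p x) * (LINT y|M2. b y * q y))
        + (LINT y|M2. (b y)\<^sup>2 * q y))"
    by (simp add: dens d_def norms power2_diff algebra_simps)
  show F: "F \<in> L2 ?M"
    using m0 F_meas by (auto simp: L2_def has_bochner_integral_iff)
  show dF: "mult_op d F \<in> L2 ?M"
    using m2 mult_op_mem_L2_iff[OF F d_meas] by (simp add: has_bochner_integral_iff)
  have unit: "L2_norm ?M F = 1"
    using m0 by (simp add: L2_norm_eq_1_iff has_bochner_integral_iff)
  show "op_expectation ?M (mult_op d) F =
      op_expectation M1 (mult_op a) f - op_expectation M2 (mult_op b) s"
    using m1 by (simp add: op_expectation_mult_op has_bochner_integral_iff p_def q_def)
  show "op_variance ?M (mult_op d) F =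
      op_variance M1 (mult_op a) f + op_variance M2 (mult_op b) s"
    \<comment> \<open>Subtracting the squared difference of the means cancels the mixed term,
      leaving one variance per factor.\<close>
    by (simp add: op_variance_mult_op F dF d_meas unit f s p_def[symmetric] q_def[symmetric]
        has_bochner_integral_integral_eq[OF m1] has_bochner_integral_integral_eq[OF m2] power2_diff)
      (simp add: p_def q_def)
qed

text \<open>A density over a sigma-finite measure is sigma-finite when it is finite almost
  everywhere; this one is finite everywhere, with value 0 at the origin.\<close>

lemma sigma_finite_window_measure: "sigma_finite_measure window_measure"
  unfolding window_measure_def
  by (subst sigma_finite_measure.sigma_finite_iff_density_finite
      [OF lborel.sigma_finite_measure_axioms]) auto

lemma window_signal_measure_eq_pair:
  "window_signal_measure = window_measure \<Otimes>\<^sub>M signal_measure"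
proof -
  \<comment> \<open>The signal factor gets the constant density 1 so that the rule for products of
    two densities applies.\<close>
  have "window_measure \<Otimes>\<^sub>M signal_measure = window_measure \<Otimes>\<^sub>M density lborel (\<lambda>_. 1)"
    by (simp add: signal_measure_def density_1)
  also have "\<dots> = density (lborel \<Otimes>\<^sub>M lborel) (\<lambda>(x, y). ennreal (1 / \<bar>x\<bar>) * 1)"
    unfolding window_measure_def
    by (rule pair_measure_density)
      (auto simp: density_1 intro: lborel.sigma_finite_measure_axioms)
  finally show ?thesis
    by (simp add: window_signal_measure_def lborel_prod)
qed

theorem proposition12:
  fixes s f :: "real \<Rightarrow> complex"
  assumes "s \<in> dom_signal"
    and "f \<in> dom_window"
    and "L2_norm window_measure f = 1"
    and "L2_norm signal_measure s = 1"
  shows "simple_tensor f s \<in> dom_scale_op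
    \<and> op_expectation window_signal_measure scale_op (simple_tensor f s) =
        - op_expectation signal_measure ln_abs_op s + op_expectation window_measure ln_abs_op f
    \<and> op_variance window_signal_measure scale_op (simple_tensor f s) =
        op_variance signal_measure ln_abs_op s + op_variance window_measure ln_abs_op f"
proof -
  interpret pair_sigma_finite window_measure signal_measure
    unfolding pair_sigma_finite_def signal_measure_def
    by (simp add: sigma_finite_window_measure lborel.sigma_finite_measure_axioms)
  have "(\<lambda>x. ln \<bar>x\<bar>) \<in> borel_measurable window_measure"
    "(\<lambda>x. ln \<bar>x\<bar>) \<in> borel_measurable signal_measure"
    by (simp_all add: window_measure_def signal_measure_def)
  \<comment> \<open>Both multipliers are the logarithm of the absolute value; the pair patterns in
    the definitions unfold to the projections used in the general lemma.\<close>
  then show ?thesis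
    using moments_difference_tensor[of f "\<lambda>x. ln \<bar>x\<bar>" s "\<lambda>x. ln \<bar>x\<bar>"] assms
    by (simp add: dom_signal_def dom_window_def dom_scale_op_def ln_abs_op_def scale_op_def
        simple_tensor_def window_signal_measure_eq_pair case_prod_unfold)
qed

end
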